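(* For extensions of domains, both implications in the hierarchy $$\mathrm{PC}\Longrightarrow\mathrm{APC}\Longrightarrow\mathrm{WPC}$$ are strict. That is: every PC extension of domains is APC and every APC extension of domains is WPC, but there exists an extension of domains that is APC and not PC, and there exists an extension of domains that is WPC and not APC.
   Context: For a domain $R$ with quotient field $Q$ and $n\ge1$, $\operatorname{Int}(R^n)=\{F\in Q[Z_1,\ldots,Z_n] : F(R^n)\subseteq R\}$, and $\operatorname{Int}(R)=\operatorname{Int}(R^1)$. Let $R\subseteq B$ be an extension of domains and put $\operatorname{Int}(R,B)=\{f\in\operatorname{Frac}(B)[Z] : f(R)\subseteq B\}$. The extension $R\subseteq B$ is polynomially complete (PC) if $\operatorname{Int}(R,B)=\operatorname{Int}(B)$; it is almost polynomially complete (APC) if $\operatorname{Int}(R^n)\subseteq\operatorname{Int}(B^n)$ for every $n\ge1$ (inclusion taken through $Q\subseteq\operatorname{Frac}(B)$); it is weakly polynomially complete (WPC) if $\operatorname{Int}(R)\subseteq\operatorname{Int}(B)$. *)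

theory Defs
  imports "HOL-Algebra.Algebra"
begin

text \<open>
  An extension of domains is presented inside an ambient field \<open>K\<close>: both rings are subdomains
  of \<open>K\<close>. Every extension \<open>R \<subseteq> B\<close> arises in this way, with \<open>K\<close> the quotient field of \<open>B\<close>.
  None of the notions below depends on \<open>K\<close> beyond the quotient field of \<open>B\<close>, and the embedding
  of the quotient field of \<open>R\<close> into that of \<open>B\<close> becomes an inclusion of subsets of \<open>K\<close>.
\<close>

definition domain_extension :: "('a, 'm) ring_scheme \<Rightarrow> 'a set \<Rightarrow> 'a set \<Rightarrow> bool" where
  "domain_extension K R B \<longleftrightarrow> field K \<and> subdomain R K \<and> subdomain B K \<and> R \<subseteq> B"

definition quotient_field :: "('a, 'm) ring_scheme \<Rightarrow> 'a set \<Rightarrow> 'a set" where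
  "quotient_field K D = {a \<otimes>\<^bsub>K\<^esub> inv\<^bsub>K\<^esub> b | a b. a \<in> D \<and> b \<in> D - {\<zero>\<^bsub>K\<^esub>}}"

text \<open>
  Polynomials are those of \<open>HOL-Algebra.Indexed_Polynomials\<close>, that is, finitely supported
  coefficient functions on monomials, a monomial being a multiset of variable indices. The library
  does not provide their evaluation at a point.
\<close>

definition mpoly_eval ::
    "('a, 'm) ring_scheme \<Rightarrow> ('v multiset \<Rightarrow> 'a) \<Rightarrow> ('v \<Rightarrow> 'a) \<Rightarrow> 'a" where
  "mpoly_eval K F x =
     (\<Oplus>\<^bsub>K\<^esub>m\<in>{m. F m \<noteq> \<zero>\<^bsub>K\<^esub>}. F m \<otimes>\<^bsub>K\<^esub> (\<Otimes>\<^bsub>K\<^esub>i\<in>set_mset m. x i [^]\<^bsub>K\<^esub> count m i))"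

text \<open>
  The polynomials in \<open>n\<close> variables over the quotient field of \<open>B\<close> that map \<open>A\<^sup>n\<close> into \<open>B\<close>. The
  variables are indexed by \<open>0, \<dots>, n - 1\<close>, and only the values of \<open>x\<close> at these indices matter.
\<close>

definition Int_between ::
    "('a, 'm) ring_scheme \<Rightarrow> nat \<Rightarrow> 'a set \<Rightarrow> 'a set \<Rightarrow> (nat multiset \<Rightarrow> 'a) set" where
  "Int_between K n A B =
     {F \<in> ring.indexed_pset K {..<n} (quotient_field K B).
        \<forall>x \<in> {..<n} \<rightarrow> A. mpoly_eval K F x \<in> B}"

definition Int_ring ::
    "('a, 'm) ring_scheme \<Rightarrow> nat \<Rightarrow> 'a set \<Rightarrow> (nat multiset \<Rightarrow> 'a) set" where
  "Int_ring K n D = Int_between K n D D"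

definition poly_complete :: "('a, 'm) ring_scheme \<Rightarrow> 'a set \<Rightarrow> 'a set \<Rightarrow> bool" where
  "poly_complete K R B \<longleftrightarrow> Int_between K 1 R B = Int_ring K 1 B"

definition almost_poly_complete :: "('a, 'm) ring_scheme \<Rightarrow> 'a set \<Rightarrow> 'a set \<Rightarrow> bool" where
  "almost_poly_complete K R B \<longleftrightarrow> (\<forall>n\<ge>1. Int_ring K n R \<subseteq> Int_ring K n B)"

definition weakly_poly_complete :: "('a, 'm) ring_scheme \<Rightarrow> 'a set \<Rightarrow> 'a set \<Rightarrow> bool" where
  "weakly_poly_complete K R B \<longleftrightarrow> Int_ring K 1 R \<subseteq> Int_ring K 1 B"

end

theory Submission
  imports Defs "HOL-Algebra.Algebraic_Closure_Type" "HOL-Library.Z2"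
begin

text \<open>
  That PC implies APC is seen by moving the coordinates of a point from \<open>R\<close> to \<open>B\<close> one at a time:
  if the other coordinates are held fixed in \<open>B\<close>, what remains is a polynomial in one variable
  over the quotient field of \<open>B\<close> that maps \<open>R\<close> into \<open>B\<close>, hence maps \<open>B\<close> into \<open>B\<close>
  (\<open>poly_complete_imp_almost_poly_complete\<close>). That APC implies WPC is the case \<open>n = 1\<close>.

  Both separating examples live in \<open>K = L(z)\<close>, where \<open>L\<close> is an infinite field of characteristic 2,
  and have the same ring on top. Put \<open>t = z\<^sup>6\<close> and consider subspaces \<open>V \<subseteq> M\<close> of \<open>L[z]\<close>,
  \<^item> \<open>V\<close> spanned by \<open>1, z\<^sup>4\<close> and all \<open>z\<^sup>i\<close> with \<open>i \<ge> 6\<close>,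
  \<^item> \<open>M\<close> spanned by \<open>1, z\<^sup>2, z\<^sup>3, z\<^sup>4\<close> and all \<open>z\<^sup>i\<close> with \<open>i \<ge> 6\<close>.

  With \<open>F\<close> the field of two elements, let \<open>R = F + tV\<close> and \<open>B = F + tM\<close>; both are rings because
  \<open>tL[z]\<close> is contained in \<open>V\<close> and in \<open>M\<close>.

  The extension \<open>F \<subseteq> B\<close> is APC but not PC. Over a field every polynomial is integer-valued, so
  APC is trivial, while \<open>(X\<^sup>2 + X) / t\<^sup>2\<close> vanishes on \<open>F\<close> and takes the value \<open>1 + 1/t \<notin> B\<close> at \<open>t\<close>.

  The extension \<open>R \<subseteq> B\<close> is WPC but not APC. The point is that \<open>M\<close> is closed under powers but not
  under products: \<open>z\<^sup>2\<close> and \<open>z\<^sup>3\<close> belong to \<open>M\<close>, their product \<open>z\<^sup>5\<close> does not, whereas squaring is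
  additive in characteristic 2 and sends \<open>M\<close> into \<open>V\<close>, and \<open>VM \<subseteq> M\<close>. A polynomial in one variable
  sees only powers: if \<open>f\<close> maps \<open>R\<close> into \<open>R\<close> and \<open>e \<in> F\<close>, then \<open>f(e + tY)\<close> maps \<open>L\<close> into
  \<open>F + tV\<close>, and since \<open>L\<close> is an infinite field, interpolation gives
  \<open>f(e + tY) = c + \<Sum>\<^sub>i h\<^sub>i Y\<^sup>i\<close> with \<open>c \<in> F\<close> and all \<open>h\<^sub>i \<in> tV\<close>. Substituting an element of
  \<open>M\<close> for \<open>Y\<close> gives an element of \<open>F + tM\<close> (\<open>maps_two_cosets\<close>). Two variables do see products:
  \<open>(X\<^sup>2 + X)(Y\<^sup>2 + Y) / t\<close> maps \<open>R \<times> R\<close> into \<open>tV\<close>, but at \<open>X = tz\<^sup>2, Y = tz\<^sup>3\<close> its value is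
  \<open>tz\<^sup>5\<close> plus terms of higher degree in \<open>z\<close>, which is not in \<open>B\<close>.

  The computations are done in the type \<open>L poly fract\<close>; as it is countable for the rational function
  field \<open>L\<close> over the two-element field, its ring structure can be carried over to natural numbers.
\<close>

section \<open>Evaluation of indexed polynomials\<close>

lemma indexed_pset_mono:
  assumes "ring K" "S \<subseteq> T" "F \<in> ring.indexed_pset K I S"
  shows "F \<in> ring.indexed_pset K I T"
proof -
  interpret ring K by fact
  show ?thesis
    using assms(3) by induction (use assms(2) in \<open>auto intro: indexed_pset.intros\<close>)
qed

context cring
begin

definition monomial_value :: "('v \<Rightarrow> 'a) \<Rightarrow> 'v multiset \<Rightarrow> 'a" where
  "monomial_value x m = (\<Otimes>i\<in>set_mset m. x i [^] count m i)"

lemma monomial_value_closed: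
  assumes "x \<in> I \<rightarrow> carrier R" "set_mset m \<subseteq> I"
  shows "monomial_value x m \<in> carrier R"
  unfolding monomial_value_def using assms by (intro finprod_closed) auto

lemma monomial_value_superset:
  assumes "x \<in> J \<rightarrow> carrier R" "finite J" "set_mset m \<subseteq> J"
  shows "monomial_value x m = (\<Otimes>i\<in>J. x i [^] count m i)"
  unfolding monomial_value_def
  by (rule finprod_mono_neutral_cong_left) (use assms in \<open>auto simp: not_in_iff\<close>)

lemma monomial_value_add_mset:
  assumes "x \<in> I \<rightarrow> carrier R" "set_mset m \<subseteq> I" "i \<in> I"
  shows "monomial_value x (add_mset i m) = monomial_value x m \<otimes> x i"
proof -
  let ?J = "set_mset m - {i}"
  have x: "x \<in> insert i ?J \<rightarrow> carrier R" using assms by auto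
  have fin: "finite (insert i ?J)" by simp
  have "monomial_value x n = x i [^] count n i \<otimes> (\<Otimes>j\<in>?J. x j [^] count n j)"
    if "set_mset n \<subseteq> insert i ?J" for n
    unfolding monomial_value_superset[OF x fin that]
    by (rule finprod_insert) (use x in auto)
  from this[of "add_mset i m"] this[of m]
  have 1: "monomial_value x (add_mset i m)
        = x i [^] Suc (count m i) \<otimes> (\<Otimes>j\<in>?J. x j [^] count (add_mset i m) j)"
    and 2: "monomial_value x m = x i [^] count m i \<otimes> (\<Otimes>j\<in>?J. x j [^] count m j)"
    by auto
  have "(\<Otimes>j\<in>?J. x j [^] count (add_mset i m) j) = (\<Otimes>j\<in>?J. x j [^] count m j)"
    by (rule finprod_cong) (use x in \<open>auto simp: simp_implies_def\<close>)
  moreover have "(\<Otimes>j\<in>?J. x j [^] count m j) \<in> carrier R"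
    using x by (intro finprod_closed) auto
  ultimately show ?thesis
    unfolding 1 2 using assms by (simp add: m_ac Pi_iff)
qed

text \<open>
  The defining sum runs over the support, which differs from polynomial to polynomial; additivity of
  the evaluation needs a common finite index set.
\<close>

lemma mpoly_eval_superset:
  assumes "finite A" "{m. F m \<noteq> \<zero>} \<subseteq> A"
    and "\<And>m. m \<in> A \<Longrightarrow> F m \<otimes> monomial_value x m \<in> carrier R"
    and "\<And>m. m \<in> A \<Longrightarrow> monomial_value x m \<in> carrier R"
  shows "mpoly_eval R F x = (\<Oplus>m\<in>A. F m \<otimes> monomial_value x m)"
  unfolding mpoly_eval_def monomial_value_def[symmetric]
  by (rule add.finprod_mono_neutral_cong_left) (use assms in auto)

lemma indexed_pset_support:
  assumes "F \<in> indexed_pset I S" "S \<subseteq> carrier R"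
  shows "finite {m. F m \<noteq> \<zero>} \<and> (\<forall>m. F m \<in> carrier R) \<and> (\<forall>m. F m \<noteq> \<zero> \<longrightarrow> set_mset m \<subseteq> I)"
  using assms(1)
proof induction
  case (indexed_const k)
  have "{m :: 'c multiset. indexed_const k m \<noteq> \<zero>} \<subseteq> {{#}}"
    by (auto simp: indexed_const_def)
  with indexed_const assms(2) show ?case
    by (auto simp: indexed_const_def intro: finite_subset)
next
  case (indexed_padd P Q)
  have "{m. indexed_padd P Q m \<noteq> \<zero>} \<subseteq> {m. P m \<noteq> \<zero>} \<union> {m. Q m \<noteq> \<zero>}"
    by (auto simp: indexed_padd_def)
  then have "finite {m. indexed_padd P Q m \<noteq> \<zero>}"
    using indexed_padd.IH by (meson finite_UnI finite_subset)
  moreover have "set_mset m \<subseteq> I" if "indexed_padd P Q m \<noteq> \<zero>" for m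
  proof -
    have "P m \<noteq> \<zero> \<or> Q m \<noteq> \<zero>" using that by (auto simp: indexed_padd_def)
    then show ?thesis using indexed_padd.IH by blast
  qed
  ultimately show ?case using indexed_padd.IH by (simp add: indexed_padd_def)
next
  case (indexed_pmult P i)
  have "{m. indexed_pmult P i m \<noteq> \<zero>} \<subseteq> add_mset i ` {m. P m \<noteq> \<zero>}"
  proof
    fix m assume "m \<in> {m. indexed_pmult P i m \<noteq> \<zero>}"
    then have "i \<in># m" "P (m - {#i#}) \<noteq> \<zero>" by (auto simp: indexed_pmult_def split: if_splits)
    then show "m \<in> add_mset i ` {m. P m \<noteq> \<zero>}"
      by (intro image_eqI[of _ _ "m - {#i#}"]) auto
  qed
  then have "finite {m. indexed_pmult P i m \<noteq> \<zero>}"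
    using indexed_pmult.IH by (meson finite_imageI finite_subset)
  moreover have "set_mset m \<subseteq> I" if "indexed_pmult P i m \<noteq> \<zero>" for m
  proof -
    have "i \<in># m" "P (m - {#i#}) \<noteq> \<zero>"
      using that by (auto simp: indexed_pmult_def split: if_splits)
    moreover from this(2) have "set_mset (m - {#i#}) \<subseteq> I" using indexed_pmult.IH by blast
    ultimately show ?thesis
      using indexed_pmult.hyps(2) by (metis insert_DiffM insert_subset set_mset_add_mset_insert)
  qed
  ultimately show ?case using indexed_pmult.IH by (simp add: indexed_pmult_def)
qed

lemma mpoly_eval_const:
  assumes "k \<in> carrier R"
  shows "mpoly_eval R (indexed_const k) x = k"
proof -
  have "mpoly_eval R (indexed_const k) x = (\<Oplus>m\<in>{{#}}. indexed_const k m \<otimes> monomial_value x m)"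
    by (rule mpoly_eval_superset) (use assms in \<open>auto simp: indexed_const_def monomial_value_def\<close>)
  with assms show ?thesis by (simp add: indexed_const_def monomial_value_def)
qed

lemma mpoly_eval_padd:
  assumes "S \<subseteq> carrier R" "P \<in> indexed_pset I S" "Q \<in> indexed_pset I S" "x \<in> I \<rightarrow> carrier R"
  shows "mpoly_eval R (indexed_padd P Q) x = mpoly_eval R P x \<oplus> mpoly_eval R Q x"
proof -
  note P = indexed_pset_support[OF assms(2,1)] and Q = indexed_pset_support[OF assms(3,1)]
  define A where "A = {m. P m \<noteq> \<zero>} \<union> {m. Q m \<noteq> \<zero>}"
  have A: "finite A" using P Q by (auto simp: A_def)
  have mv: "monomial_value x m \<in> carrier R" if "m \<in> A" for m
    using that P Q assms(4) by (intro monomial_value_closed) (auto simp: A_def)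
  have "mpoly_eval R (indexed_padd P Q) x
      = (\<Oplus>m\<in>A. indexed_padd P Q m \<otimes> monomial_value x m)"
    by (rule mpoly_eval_superset) (use A mv P Q in \<open>auto simp: A_def indexed_padd_def\<close>)
  also have "\<dots> = (\<Oplus>m\<in>A. P m \<otimes> monomial_value x m \<oplus> Q m \<otimes> monomial_value x m)"
    by (rule add.finprod_cong) (use mv P Q in \<open>auto simp: indexed_padd_def l_distr simp_implies_def\<close>)
  also have "\<dots> = (\<Oplus>m\<in>A. P m \<otimes> monomial_value x m) \<oplus> (\<Oplus>m\<in>A. Q m \<otimes> monomial_value x m)"
    by (rule add.finprod_multf) (use mv P Q in auto)
  also have "(\<Oplus>m\<in>A. P m \<otimes> monomial_value x m) = mpoly_eval R P x"
    by (rule mpoly_eval_superset[symmetric]) (use A mv P in \<open>auto simp: A_def\<close>)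
  also have "(\<Oplus>m\<in>A. Q m \<otimes> monomial_value x m) = mpoly_eval R Q x"
    by (rule mpoly_eval_superset[symmetric]) (use A mv Q in \<open>auto simp: A_def\<close>)
  finally show ?thesis .
qed

lemma mpoly_eval_pmult:
  assumes "S \<subseteq> carrier R" "P \<in> indexed_pset I S" "i \<in> I" "x \<in> I \<rightarrow> carrier R"
  shows "mpoly_eval R (indexed_pmult P i) x = mpoly_eval R P x \<otimes> x i"
proof -
  note P = indexed_pset_support[OF assms(2,1)]
  define A where "A = {m. P m \<noteq> \<zero>}"
  have A: "finite A" using P by (auto simp: A_def)
  have sub: "set_mset m \<subseteq> I" if "m \<in> A" for m using that P by (auto simp: A_def)
  have mv: "monomial_value x m \<in> carrier R" if "m \<in> A" for m
    using sub[OF that] assms(4) by (intro monomial_value_closed)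
  have xi: "x i \<in> carrier R" using assms by auto
  have mv': "monomial_value x (add_mset i m) = monomial_value x m \<otimes> x i" if "m \<in> A" for m
    using monomial_value_add_mset[OF assms(4) sub[OF that] assms(3)] .
  have "{m. indexed_pmult P i m \<noteq> \<zero>} \<subseteq> add_mset i ` A"
  proof
    fix m assume "m \<in> {m. indexed_pmult P i m \<noteq> \<zero>}"
    then have "i \<in># m" "P (m - {#i#}) \<noteq> \<zero>" by (auto simp: indexed_pmult_def split: if_splits)
    then show "m \<in> add_mset i ` A"
      unfolding A_def by (intro image_eqI[of _ _ "m - {#i#}"]) auto
  qed
  then have "mpoly_eval R (indexed_pmult P i) x
      = (\<Oplus>m\<in>add_mset i ` A. indexed_pmult P i m \<otimes> monomial_value x m)"
    by (intro mpoly_eval_superset) (use A mv mv' P xi in \<open>auto simp: indexed_pmult_def\<close>)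
  also have "\<dots> = (\<Oplus>m\<in>A. indexed_pmult P i (add_mset i m) \<otimes> monomial_value x (add_mset i m))"
    by (rule add.finprod_reindex) (use mv mv' P xi in \<open>auto simp: indexed_pmult_def inj_on_def\<close>)
  also have "\<dots> = (\<Oplus>m\<in>A. P m \<otimes> monomial_value x m \<otimes> x i)"
    by (rule add.finprod_cong) (use mv mv' P xi in \<open>auto simp: indexed_pmult_def simp_implies_def m_assoc\<close>)
  also have "\<dots> = (\<Oplus>m\<in>A. P m \<otimes> monomial_value x m) \<otimes> x i"
    by (rule finsum_ldistr[symmetric]) (use A mv P xi in auto)
  also have "(\<Oplus>m\<in>A. P m \<otimes> monomial_value x m) = mpoly_eval R P x"
    by (rule mpoly_eval_superset[symmetric]) (use A mv P in \<open>auto simp: A_def\<close>)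
  finally show ?thesis .
qed

text \<open>
  Used with \<open>T\<close> the larger ring of an extension, and with \<open>T\<close> the carrier.
\<close>

lemma mpoly_eval_closed:
  assumes "S \<subseteq> T" "F \<in> indexed_pset I S" "x \<in> I \<rightarrow> T" "T \<subseteq> carrier R"
    and "\<And>a b. a \<in> T \<Longrightarrow> b \<in> T \<Longrightarrow> a \<oplus> b \<in> T" "\<And>a b. a \<in> T \<Longrightarrow> b \<in> T \<Longrightarrow> a \<otimes> b \<in> T"
  shows "mpoly_eval R F x \<in> T"
proof -
  have S: "S \<subseteq> carrier R" and x: "x \<in> I \<rightarrow> carrier R" using assms by auto
  show ?thesis
    using assms(2)
  proof induction
    case (indexed_const k)
    with assms(1) S show ?case by (subst mpoly_eval_const) auto
  next
    case (indexed_padd P Q)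
    with assms(5) show ?case by (simp add: mpoly_eval_padd[OF S _ _ x])
  next
    case (indexed_pmult P i)
    with assms(3,6) show ?case by (auto simp: mpoly_eval_pmult[OF S _ _ x])
  qed
qed

end

section \<open>The implications\<close>

lemma subset_quotient_field:
  assumes "field K" "subdomain D K"
  shows "D \<subseteq> quotient_field K D"
proof
  interpret field K by fact
  fix a assume a: "a \<in> D"
  have "a = a \<otimes>\<^bsub>K\<^esub> inv\<^bsub>K\<^esub> \<one>\<^bsub>K\<^esub>"
    using a subdomainE(1)[OF assms(2)] by auto
  moreover have "\<one>\<^bsub>K\<^esub> \<in> D - {\<zero>\<^bsub>K\<^esub>}" using subdomainE(3)[OF assms(2)] by simp
  ultimately show "a \<in> quotient_field K D"
    unfolding quotient_field_def using a by (intro CollectI exI conjI)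
qed

lemma quotient_field_in_carrier:
  assumes "field K" "subdomain D K"
  shows "quotient_field K D \<subseteq> carrier K"
proof -
  interpret field K by fact
  show ?thesis
    using subdomainE(1)[OF assms(2)] unfolding quotient_field_def
    by (auto simp: field_Units intro!: m_closed Units_inv_closed)
qed

lemma quotient_field_mono: "D \<subseteq> E \<Longrightarrow> quotient_field K D \<subseteq> quotient_field K E"
  unfolding quotient_field_def by blast

lemma quotient_field_mult_closed:
  assumes "field K" "subdomain D K" "a \<in> quotient_field K D" "b \<in> quotient_field K D"
  shows "a \<otimes>\<^bsub>K\<^esub> b \<in> quotient_field K D"
proof -
  interpret field K by fact
  note D = subdomainE[OF assms(2)]
  obtain p q r s where p: "a = p \<otimes>\<^bsub>K\<^esub> inv\<^bsub>K\<^esub> q" "b = r \<otimes>\<^bsub>K\<^esub> inv\<^bsub>K\<^esub> s" "p \<in> D" "r \<in> D"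
      "q \<in> D" "q \<noteq> \<zero>\<^bsub>K\<^esub>" "s \<in> D" "s \<noteq> \<zero>\<^bsub>K\<^esub>"
    using assms(3,4) unfolding quotient_field_def by blast
  have c: "p \<in> carrier K" "r \<in> carrier K" "q \<in> carrier K" "s \<in> carrier K"
    "q \<in> Units K" "s \<in> Units K" "inv\<^bsub>K\<^esub> q \<in> carrier K" "inv\<^bsub>K\<^esub> s \<in> carrier K"
    using D(1) p by (auto simp: field_Units intro!: Units_inv_closed)
  have "inv\<^bsub>K\<^esub> (q \<otimes>\<^bsub>K\<^esub> s) = inv\<^bsub>K\<^esub> q \<otimes>\<^bsub>K\<^esub> inv\<^bsub>K\<^esub> s"
  proof (rule comm_inv_char)
    have "q \<otimes>\<^bsub>K\<^esub> s \<otimes>\<^bsub>K\<^esub> (inv\<^bsub>K\<^esub> q \<otimes>\<^bsub>K\<^esub> inv\<^bsub>K\<^esub> s)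
        = (q \<otimes>\<^bsub>K\<^esub> inv\<^bsub>K\<^esub> q) \<otimes>\<^bsub>K\<^esub> (s \<otimes>\<^bsub>K\<^esub> inv\<^bsub>K\<^esub> s)"
      using c by (simp only: m_ac m_closed)
    with c show "q \<otimes>\<^bsub>K\<^esub> s \<otimes>\<^bsub>K\<^esub> (inv\<^bsub>K\<^esub> q \<otimes>\<^bsub>K\<^esub> inv\<^bsub>K\<^esub> s) = \<one>\<^bsub>K\<^esub>" by simp
  qed (use c in auto)
  then have "a \<otimes>\<^bsub>K\<^esub> b = (p \<otimes>\<^bsub>K\<^esub> r) \<otimes>\<^bsub>K\<^esub> inv\<^bsub>K\<^esub> (q \<otimes>\<^bsub>K\<^esub> s)"
    unfolding p using c by (simp add: m_ac)
  moreover have "p \<otimes>\<^bsub>K\<^esub> r \<in> D" "q \<otimes>\<^bsub>K\<^esub> s \<in> D - {\<zero>\<^bsub>K\<^esub>}"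
    using c p D(6) integral by auto
  ultimately show ?thesis
    unfolding quotient_field_def by (intro CollectI exI conjI)
qed

text \<open>
  The generators of \<open>indexed_pset\<close> multiply by variables only, so that scaling by a coefficient has to be
  pushed down to the constants.
\<close>

lemma (in cring) indexed_pset_scalar_multiple:
  assumes "S \<subseteq> carrier R" "\<And>a b. a \<in> S \<Longrightarrow> b \<in> S \<Longrightarrow> a \<otimes> b \<in> S" "c \<in> S" "F \<in> indexed_pset I S"
  shows "\<exists>G\<in>indexed_pset I S. \<forall>x\<in>I \<rightarrow> carrier R. mpoly_eval R G x = c \<otimes> mpoly_eval R F x"
  using assms(4)
proof induction
  case (indexed_const k)
  then show ?case
    using assms(1-3)
    by (intro bexI[of _ "indexed_const (c \<otimes> k)"] indexed_pset.indexed_const)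
      (auto simp: mpoly_eval_const subset_iff)
next
  case (indexed_padd P Q)
  then obtain P' Q' where *: "P' \<in> indexed_pset I S" "Q' \<in> indexed_pset I S"
    "\<forall>x\<in>I \<rightarrow> carrier R. mpoly_eval R P' x = c \<otimes> mpoly_eval R P x"
    "\<forall>x\<in>I \<rightarrow> carrier R. mpoly_eval R Q' x = c \<otimes> mpoly_eval R Q x" by blast
  then show ?case
    using indexed_padd.hyps assms(1,3)
    by (intro bexI[of _ "indexed_padd P' Q'"] indexed_pset.indexed_padd)
      (auto simp: mpoly_eval_padd[OF assms(1)] mpoly_eval_closed[OF assms(1) _ _ subset_refl] r_distr subset_iff)
next
  case (indexed_pmult P i)
  then obtain P' where *: "P' \<in> indexed_pset I S"
    "\<forall>x\<in>I \<rightarrow> carrier R. mpoly_eval R P' x = c \<otimes> mpoly_eval R P x" by blast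
  then show ?case
    using indexed_pmult.hyps assms(1,3)
    by (intro bexI[of _ "indexed_pmult P' i"] indexed_pset.indexed_pmult)
      (auto simp: mpoly_eval_pmult[OF assms(1)] mpoly_eval_closed[OF assms(1) _ _ subset_refl] m_assoc subset_iff Pi_iff)
qed

text \<open>
  All variables but the \<open>k\<close>-th are replaced by the values that \<open>x\<close> gives them; multiplication by such a
  variable becomes scaling by its value.
\<close>

lemma (in cring) one_variable_specialisation:
  assumes "S \<subseteq> carrier R" "\<And>a b. a \<in> S \<Longrightarrow> b \<in> S \<Longrightarrow> a \<otimes> b \<in> S"
    and "F \<in> indexed_pset I S" "x \<in> I \<rightarrow> S"
  shows "\<exists>G\<in>indexed_pset {..<1::nat} S. \<forall>y\<in>{..<1::nat} \<rightarrow> carrier R.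
           mpoly_eval R G y = mpoly_eval R F (x(k := y 0))"
proof -
  have xy: "x(k := y 0) \<in> I \<rightarrow> carrier R" if "y \<in> {..<1::nat} \<rightarrow> carrier R" for y
  proof (rule Pi_I)
    fix i assume "i \<in> I"
    then have "x i \<in> carrier R" using assms(1,4) by blast
    moreover have "y 0 \<in> carrier R" using that by (simp add: Pi_iff)
    ultimately show "(x(k := y 0)) i \<in> carrier R" by simp
  qed
  show ?thesis
    using assms(3)
  proof induction
    case (indexed_const c)
    then have "c \<in> carrier R" using assms(1) by blast
    with indexed_const show ?case
      by (intro bexI[of _ "indexed_const c"] indexed_pset.indexed_const)
        (auto simp: mpoly_eval_const)
  next
    case (indexed_padd P Q)
    then obtain P' Q' where P': "P' \<in> indexed_pset {..<1::nat} S" "Q' \<in> indexed_pset {..<1::nat} S"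
      "\<forall>y\<in>{..<1::nat} \<rightarrow> carrier R. mpoly_eval R P' y = mpoly_eval R P (x(k := y 0))"
      "\<forall>y\<in>{..<1::nat} \<rightarrow> carrier R. mpoly_eval R Q' y = mpoly_eval R Q (x(k := y 0))" by blast
    have "mpoly_eval R (indexed_padd P' Q') y = mpoly_eval R (indexed_padd P Q) (x(k := y 0))"
      if y: "y \<in> {..<1::nat} \<rightarrow> carrier R" for y
      using P'(3,4) y
      by (simp only: mpoly_eval_padd[OF assms(1) P'(1,2) y]
        mpoly_eval_padd[OF assms(1) indexed_padd.hyps xy[OF y]])
    then show ?case
      by (intro bexI[of _ "indexed_padd P' Q'"] ballI indexed_pset.indexed_padd P'(1,2))
  next
    case (indexed_pmult P i)
    then obtain P' where P': "P' \<in> indexed_pset {..<1::nat} S"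
      "\<forall>y\<in>{..<1::nat} \<rightarrow> carrier R. mpoly_eval R P' y = mpoly_eval R P (x(k := y 0))" by blast
    show ?case
    proof (cases "i = k")
      case True
      have "mpoly_eval R (indexed_pmult P' 0) y = mpoly_eval R (indexed_pmult P i) (x(k := y 0))"
        if y: "y \<in> {..<1::nat} \<rightarrow> carrier R" for y
        using P'(2) y True mpoly_eval_pmult[OF assms(1) P'(1) _ y, of 0]
          mpoly_eval_pmult[OF assms(1) indexed_pmult.hyps xy[OF y]]
        by simp
      moreover have "indexed_pmult P' 0 \<in> indexed_pset {..<1::nat} S"
        using P'(1) by (rule indexed_pset.indexed_pmult) simp
      ultimately show ?thesis by (intro bexI[of _ "indexed_pmult P' 0"] ballI)
    next
      case False
      have xi: "x i \<in> S" using assms(4) indexed_pmult.hyps by auto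
      from indexed_pset_scalar_multiple[OF assms(1,2) xi P'(1)] obtain G where G:
        "G \<in> indexed_pset {..<1::nat} S"
        "\<forall>y\<in>{..<1::nat} \<rightarrow> carrier R. mpoly_eval R G y = x i \<otimes> mpoly_eval R P' y" by blast
      have "mpoly_eval R G y = mpoly_eval R (indexed_pmult P i) (x(k := y 0))"
        if y: "y \<in> {..<1::nat} \<rightarrow> carrier R" for y
      proof -
        have "mpoly_eval R P (x(k := y 0)) \<in> carrier R"
          by (rule mpoly_eval_closed[OF assms(1) indexed_pmult.hyps(1) xy[OF y]]) auto
        moreover have "x i \<in> carrier R" using xi assms(1) by blast
        ultimately show ?thesis
          using G(2) P'(2) y False
          by (simp add: mpoly_eval_pmult[OF assms(1) indexed_pmult.hyps xy[OF y]] m_comm)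
      qed
      then show ?thesis by (intro bexI[OF _ G(1)] ballI)
    qed
  qed
qed

text \<open>
  The induction is over the number \<open>k\<close> of leading coordinates that are allowed to lie in \<open>B\<close>, the
  others still being in \<open>R\<close>. Raising \<open>k\<close> by one is polynomial completeness applied to the
  specialisation at all the other coordinates, whose coefficients lie in the quotient field of \<open>B\<close>.
\<close>

lemma poly_complete_imp_almost_poly_complete:
  assumes ext: "domain_extension K R B" and pc: "poly_complete K R B"
  shows "almost_poly_complete K R B"
  unfolding almost_poly_complete_def
proof (intro allI impI subsetI)
  fix n :: nat and F
  assume F: "F \<in> Int_ring K n R"
  have K: "field K" and R: "subdomain R K" and B: "subdomain B K" and RB: "R \<subseteq> B"
    using ext by (auto simp: domain_extension_def)
  interpret field K by (rule K)
  let ?Q = "quotient_field K B"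
  have FB: "F \<in> indexed_pset {..<n} ?Q"
    using F indexed_pset_mono[OF ring_axioms quotient_field_mono[OF RB]]
    by (auto simp: Int_ring_def Int_between_def)
  have BQ: "B \<subseteq> ?Q" and QK: "?Q \<subseteq> carrier K"
    using subset_quotient_field quotient_field_in_carrier K B by blast+
  have "mpoly_eval K F x \<in> B" if "k \<le> n" "x \<in> {..<k} \<rightarrow> B" "x \<in> {k..<n} \<rightarrow> R" for k x
    using that
  proof (induction k arbitrary: x)
    case 0
    then have "x \<in> {..<n} \<rightarrow> R" by auto
    then have "mpoly_eval K F x \<in> R" using F by (simp add: Int_ring_def Int_between_def)
    with RB show ?case by blast
  next
    case (Suc k)
    have B_all: "x i \<in> B" if "i < n" for i
      using that Suc.prems RB by (cases "i < Suc k") (auto simp: Pi_iff subset_iff)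
    have "x \<in> {..<n} \<rightarrow> ?Q" using B_all BQ by (auto intro!: Pi_I)
    from one_variable_specialisation[OF QK quotient_field_mult_closed[OF K B] FB this]
    obtain G where G: "G \<in> indexed_pset {..<1::nat} ?Q"
      "\<forall>y\<in>{..<1::nat} \<rightarrow> carrier K. mpoly_eval K G y = mpoly_eval K F (x(k := y 0))"
      by blast
    have "mpoly_eval K G y \<in> B" if y: "y \<in> {..<1} \<rightarrow> R" for y
    proof -
      have "mpoly_eval K F (x(k := y 0)) \<in> B"
        by (rule Suc.IH) (use Suc.prems y in \<open>auto simp: Pi_iff\<close>)
      moreover have "y \<in> {..<1} \<rightarrow> carrier K" using y subdomainE(1)[OF R] by blast
      ultimately show ?thesis using G(2) by simp
    qed
    with G(1) have "G \<in> Int_between K 1 R B" by (simp add: Int_between_def)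
    then have "G \<in> Int_ring K 1 B" using pc by (simp add: poly_complete_def)
    moreover have xk: "x k \<in> B" using B_all Suc.prems by auto
    ultimately have "mpoly_eval K G (\<lambda>_. x k) \<in> B"
      by (simp add: Int_ring_def Int_between_def)
    moreover have "(\<lambda>_. x k) \<in> {..<1::nat} \<rightarrow> carrier K"
      using xk subdomainE(1)[OF B] by blast
    ultimately show ?case using G(2) by force
  qed
  from this[of n] FB show "F \<in> Int_ring K n B"
    by (simp add: Int_ring_def Int_between_def)
qed

lemma almost_poly_complete_imp_weakly_poly_complete:
  "almost_poly_complete K R B \<Longrightarrow> weakly_poly_complete K R B"
  by (simp add: almost_poly_complete_def weakly_poly_complete_def)

text \<open>
  If \<open>R\<close> is a field, \<open>Int(R\<^sup>n)\<close> consists of polynomials over \<open>R\<close> itself, and these map every ring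
  containing \<open>R\<close> into itself.
\<close>

lemma subfield_imp_almost_poly_complete:
  assumes ext: "domain_extension K R B" and field: "quotient_field K R = R"
  shows "almost_poly_complete K R B"
  unfolding almost_poly_complete_def
proof (intro allI impI subsetI)
  fix n :: nat and F
  assume "F \<in> Int_ring K n R"
  then have F: "F \<in> ring.indexed_pset K {..<n} R"
    using field by (auto simp: Int_ring_def Int_between_def)
  have K: "field K" and B: "subdomain B K" and RB: "R \<subseteq> B"
    using ext by (auto simp: domain_extension_def)
  interpret field K by (rule K)
  have "F \<in> indexed_pset {..<n} (quotient_field K B)"
    using indexed_pset_mono[OF ring_axioms _ F] RB subset_quotient_field[OF K B] by blast
  moreover have "mpoly_eval K F x \<in> B" if "x \<in> {..<n} \<rightarrow> B" for x
    by (rule mpoly_eval_closed[OF RB F that]) (use subdomainE[OF B] in auto)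
  ultimately show "F \<in> Int_ring K n B" by (auto simp: Int_ring_def Int_between_def)
qed

section \<open>Interpolation and rings of the form F + tV\<close>

text \<open>
  Lagrange interpolation at points of a subfield \<open>L\<close>, whose differences are invertible in \<open>L\<close>, shows
  that the coefficients are \<open>L\<close>-linear combinations of values. The induction uses divided
  differences instead: dividing \<open>p - p(a)\<close> by \<open>X - a\<close> lowers the degree, and the quotient has its values
  at the remaining points in \<open>I\<close> again.
\<close>

lemma coeffs_in_subspace_if_infinitely_many_values:
  fixes L I :: "'k::field set" and p :: "'k poly"
  assumes "\<And>a b. a \<in> L \<Longrightarrow> b \<in> L \<Longrightarrow> a - b \<in> L" "\<And>a. a \<in> L \<Longrightarrow> inverse a \<in> L"
    and "0 \<in> I" "\<And>u v. u \<in> I \<Longrightarrow> v \<in> I \<Longrightarrow> u - v \<in> I" "\<And>a u. a \<in> L \<Longrightarrow> u \<in> I \<Longrightarrow> a * u \<in> I"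
    and "infinite A" "A \<subseteq> L" "\<And>a. a \<in> A \<Longrightarrow> poly p a \<in> I"
  shows "coeff p i \<in> I"
  using assms(6-8)
proof (induction "degree p" arbitrary: p A i rule: less_induct)
  case less
  have "A \<noteq> {}" using less.prems(1) by auto
  then obtain a where a: "a \<in> A" by blast
  show ?case
  proof (cases "degree p = 0")
    case True
    then obtain c where "p = [:c:]" by (metis degree_eq_zeroE)
    with less.prems(3)[OF a] assms(3) show ?thesis by (cases i) auto
  next
    case False
    define q where "q = synthetic_div p a"
    have p: "p = [:poly p a:] + [:-a, 1:] * q"
      using synthetic_div_correct'[of a p] by (simp add: q_def algebra_simps)
    have "coeff q j \<in> I" for j
    proof (rule less.hyps[of q "A - {a}"])
      show "degree q < degree p" using False by (simp add: q_def degree_synthetic_div)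
      show "infinite (A - {a})" "A - {a} \<subseteq> L" using less.prems by auto
      fix b assume b: "b \<in> A - {a}"
      have "poly p b = poly p a + (b - a) * poly q b"
        by (subst p) (simp add: algebra_simps)
      then have "poly q b = inverse (b - a) * (poly p b - poly p a)"
        using b by (simp add: field_simps)
      then show "poly q b \<in> I"
        using a b less.prems by (auto intro!: assms)
    qed
    moreover have "coeff p i = (if i = 0 then poly p a else coeff q (i - 1)) - a * coeff q i"
      by (subst p) (cases i; simp)
    ultimately show ?thesis
      using a less.prems by (auto intro!: assms)
  qed
qed

text \<open>
  In characteristic 2 this is \<open>F + tV\<close> with \<open>F\<close> the prime field.
\<close>

definition two_cosets :: "'k::field \<Rightarrow> 'k set \<Rightarrow> 'k set" where
  "two_cosets t V = {e + t * v | e v. e \<in> {0, 1} \<and> v \<in> V}"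

lemma two_cosetsI: "e \<in> {0, 1} \<Longrightarrow> v \<in> V \<Longrightarrow> e + t * v \<in> two_cosets t V"
  by (auto simp: two_cosets_def)

text \<open>
  This is the reason for weak polynomial completeness. The values of \<open>p(e + tY)\<close> on \<open>L\<close> lie in two
  cosets of \<open>tV\<close>; one of them is met infinitely often, so interpolation puts all coefficients, up to the
  constant \<open>0\<close> or \<open>1\<close>, into \<open>tV\<close>. As squares of elements of \<open>M\<close> fall into \<open>V\<close> and \<open>V\<close> acts on \<open>M\<close>,
  all powers of elements of \<open>M\<close> remain in \<open>M\<close>, even though products of distinct elements need not.
\<close>

lemma maps_two_cosets:
  fixes L V M :: "'k::field set" and p :: "'k poly"
  assumes L: "infinite L" "\<And>a b. a \<in> L \<Longrightarrow> b \<in> L \<Longrightarrow> a - b \<in> L" "\<And>a. a \<in> L \<Longrightarrow> inverse a \<in> L"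
    and V: "0 \<in> V" "\<And>u v. u \<in> V \<Longrightarrow> v \<in> V \<Longrightarrow> u - v \<in> V" "\<And>a u. a \<in> L \<Longrightarrow> u \<in> V \<Longrightarrow> a * u \<in> V"
      "L \<subseteq> V"
    and M: "0 \<in> M" "1 \<in> M" "\<And>u v. u \<in> M \<Longrightarrow> v \<in> M \<Longrightarrow> u + v \<in> M"
      "\<And>v m. v \<in> V \<Longrightarrow> m \<in> M \<Longrightarrow> v * m \<in> M" "\<And>m. m \<in> M \<Longrightarrow> m * m \<in> V"
    and p: "\<And>a. a \<in> two_cosets t V \<Longrightarrow> poly p a \<in> two_cosets t V"
    and b: "b \<in> two_cosets t M"
  shows "poly p b \<in> two_cosets t M"
proof -
  define I where "I = (\<lambda>v. t * v) ` V"
  obtain e m where e: "e \<in> {0, 1}" and m: "m \<in> M" and b_eq: "b = e + t * m"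
    using b by (auto simp: two_cosets_def)
  define q where "q = pcompose p [:e, t:]"
  have poly_q: "poly q a = poly p (e + t * a)" for a
    by (simp add: q_def poly_pcompose algebra_simps)
  have "\<exists>c\<in>{0, 1}. poly q a - c \<in> I" if "a \<in> L" for a
  proof -
    have "e + t * a \<in> two_cosets t V" using that e V(4) by (auto intro!: two_cosetsI)
    from p[OF this] show ?thesis
      unfolding poly_q by (force simp: two_cosets_def I_def)
  qed
  then have "L \<subseteq> (\<Union>c\<in>{0, 1}. {a \<in> L. poly q a - c \<in> I})" by auto
  with L(1) have "\<exists>c\<in>{0, 1}. infinite {a \<in> L. poly q a - c \<in> I}"
    by (meson finite_UN finite.emptyI finite.insertI finite_subset)
  then obtain c where c: "c \<in> {0, 1}" "infinite {a \<in> L. poly q a - c \<in> I}" by blast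
  define r where "r = q - [:c:]"
  have coeff_r: "coeff r i \<in> I" for i
  proof (rule coeffs_in_subspace_if_infinitely_many_values[OF L(2,3) _ _ _ c(2)])
    show "0 \<in> I" using V(1) by (force simp: I_def)
    show "u - v \<in> I" if "u \<in> I" "v \<in> I" for u v
      using that V(2) by (auto simp: I_def right_diff_distrib[symmetric])
    show "a * u \<in> I" if "a \<in> L" "u \<in> I" for a u
      using that V(3) by (auto simp: I_def mult.left_commute)
  qed (auto simp: r_def)
  \<comment> \<open>split off a factor \<open>m\<^sup>2 \<in> V\<close>, which acts on \<open>M\<close>\<close>
  have pow: "m ^ i \<in> M" for i
  proof (induction i rule: nat_less_induct)
    case (1 i)
    consider "i = 0" | "i = 1" | j where "i = Suc (Suc j)" by (metis One_nat_def not0_implies_Suc)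
    then show ?case
    proof cases
      case (3 j)
      then have "m ^ i = (m * m) * m ^ j" by (simp add: mult.assoc)
      moreover have "m ^ j \<in> M" using 1 3 by simp
      ultimately show ?thesis using M(4)[OF M(5)[OF m]] by simp
    qed (use M m in auto)
  qed
  have sum_mem: "(\<Sum>i\<in>N. coeff r i * m ^ i) \<in> (\<lambda>v. t * v) ` M" for N
  proof (induction N rule: infinite_finite_induct)
    case (insert i N)
    obtain v where "v \<in> V" "coeff r i = t * v" using coeff_r[of i] by (auto simp: I_def)
    then have "coeff r i * m ^ i = t * (v * m ^ i)" "v * m ^ i \<in> M"
      using M(4) pow by (simp_all add: mult.assoc)
    moreover obtain w where "w \<in> M" "(\<Sum>j\<in>N. coeff r j * m ^ j) = t * w"
      using insert.IH by blast
    ultimately have "(\<Sum>j\<in>insert i N. coeff r j * m ^ j) = t * (v * m ^ i + w)"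
        "v * m ^ i + w \<in> M"
      using insert.hyps M(3) by (simp_all add: distrib_left)
    then show ?case by (rule image_eqI)
  qed (use M(1) in force)+
  have "poly p b = c + poly r m" by (simp add: b_eq poly_q[symmetric] r_def)
  moreover obtain w where "w \<in> M" "poly r m = t * w"
    using sum_mem unfolding poly_altdef by blast
  ultimately show ?thesis using two_cosetsI[OF c(1)] by simp
qed

lemma two_cosets_closed:
  fixes V :: "'k::field set"
  assumes two: "(2::'k) = 0"
    and V: "0 \<in> V" "\<And>u v. u \<in> V \<Longrightarrow> v \<in> V \<Longrightarrow> u + v \<in> V"
      "\<And>u v. u \<in> V \<Longrightarrow> v \<in> V \<Longrightarrow> t * (u * v) \<in> V"
  shows "1 \<in> two_cosets t V"
    and "a \<in> two_cosets t V \<Longrightarrow> - a \<in> two_cosets t V"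
    and "a \<in> two_cosets t V \<Longrightarrow> b \<in> two_cosets t V \<Longrightarrow> a + b \<in> two_cosets t V"
    and "a \<in> two_cosets t V \<Longrightarrow> b \<in> two_cosets t V \<Longrightarrow> a * b \<in> two_cosets t V"
proof -
  have "x + x = 0" for x :: 'k using two by (metis mult_2 mult_zero_left)
  then have neg: "- x = x" for x :: 'k by (simp add: neg_eq_iff_add_eq_0)
  have one: "1 + 1 = (0::'k)" using two by simp
  show "1 \<in> two_cosets t V" using V(1) by (force simp: two_cosets_def)
  show "a \<in> two_cosets t V \<Longrightarrow> - a \<in> two_cosets t V" by (simp add: neg)
  assume "a \<in> two_cosets t V" "b \<in> two_cosets t V"
  then obtain e u f v where
    ab: "a = e + t * u" "b = f + t * v" "e \<in> {0, 1}" "f \<in> {0, 1}" "u \<in> V" "v \<in> V"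
    by (auto simp: two_cosets_def)
  have "a + b = (e + f) + t * (u + v)" using ab by (simp add: algebra_simps)
  moreover have "e + f \<in> {0, 1}" using ab one by auto
  ultimately show "a + b \<in> two_cosets t V" using ab V(2) by (simp only: two_cosetsI)
  have "a * b = e * f + t * (e * v + f * u + t * (u * v))" using ab by (simp add: algebra_simps)
  moreover have "e * f \<in> {0, 1}" "e * v + f * u + t * (u * v) \<in> V"
    using ab V by auto
  ultimately show "a * b \<in> two_cosets t V" by (simp only: two_cosetsI)
qed

text \<open>
  The polynomial \<open>X\<^sup>2 + X\<close> is additive in characteristic 2 and vanishes at \<open>0\<close> and \<open>1\<close>, hence maps
  \<open>F + tV\<close> to multiples of \<open>t\<close>.
\<close>

lemma square_add_self_two_cosets:
  fixes a :: "'k::field"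
  assumes "(2::'k) = 0" "a = e + t * v" "e \<in> {0, 1}"
  shows "a ^ 2 + a = t * (v + t * (v * v))"
proof -
  have "a ^ 2 + a = (e * e + e) + 2 * (e * t * v) + t * (v + t * (v * v))"
    by (simp add: assms(2) power2_eq_square algebra_simps)
  moreover have "e * e + e = 0" using assms(1,3) by auto
  ultimately show ?thesis using assms(1) by simp
qed

section \<open>Transport along an injection of a field type\<close>

text \<open>
  An injection \<open>h\<close> of a field type carries the field structure over to its range. Subrings, quotient
  fields and values of polynomials can then be computed in the field type.
\<close>

locale embedded_field =
  fixes h :: "'k::field \<Rightarrow> 'b"
  assumes inj_h: "inj h"
begin

definition K :: "'b ring" where
  "K = image_ring h ring_of_type_algebra"

lemma inv_into_h [simp]: "inv_into UNIV h (h a) = a"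
  using inj_h by (simp add: inv_f_f)

lemma K_simps [simp]:
  "carrier K = range h"
  "\<zero>\<^bsub>K\<^esub> = h 0" "\<one>\<^bsub>K\<^esub> = h 1"
  "h a \<oplus>\<^bsub>K\<^esub> h b = h (a + b)" "h a \<otimes>\<^bsub>K\<^esub> h b = h (a * b)"
  by (simp_all add: K_def image_ring_def image_group_def monoid.defs ring_of_type_algebra_def)

lemma h_eq_iff [simp]: "h a = h b \<longleftrightarrow> a = b"
  using inj_h by (simp add: inj_eq)

lemma field_K: "field K"
  unfolding K_def
  by (rule field.inj_imp_image_ring_is_field[OF field_from_type_algebra])
    (use inj_h in \<open>auto simp: ring_of_type_algebra_def\<close>)

sublocale K: field K
  by (rule field_K)

lemma a_inv_h: "\<ominus>\<^bsub>K\<^esub> h a = h (- a)"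
  by (rule K.minus_equality) simp_all

lemma m_inv_h: "a \<noteq> 0 \<Longrightarrow> inv\<^bsub>K\<^esub> h a = h (inverse a)"
  by (rule K.comm_inv_char) simp_all

lemma subdomain_image:
  assumes "1 \<in> D" "\<And>a. a \<in> D \<Longrightarrow> - a \<in> D"
    "\<And>a b. a \<in> D \<Longrightarrow> b \<in> D \<Longrightarrow> a + b \<in> D" "\<And>a b. a \<in> D \<Longrightarrow> b \<in> D \<Longrightarrow> a * b \<in> D"
  shows "subdomain (h ` D) K"
proof (rule K.subdomainI', rule K.subringI)
qed (use assms in \<open>auto simp: a_inv_h\<close>)

lemma quotient_field_memI:
  "a \<in> D \<Longrightarrow> b \<in> D \<Longrightarrow> b \<noteq> 0 \<Longrightarrow> h (a / b) \<in> quotient_field K (h ` D)"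
  unfolding quotient_field_def
  by (rule CollectI, rule exI[of _ "h a"], rule exI[of _ "h b"])
    (auto simp: m_inv_h divide_inverse)

lemma one_variable_poly_exists:
  assumes "F \<in> K.indexed_pset {..<1::nat} (carrier K)"
  shows "\<exists>p. \<forall>x a. x 0 = h a \<longrightarrow> mpoly_eval K F x = h (poly p a)"
  using assms
proof induction
  case (indexed_const k)
  then obtain c where "k = h c" by auto
  then have "\<forall>x a. x 0 = h a \<longrightarrow> mpoly_eval K (K.indexed_const k) x = h (poly [:c:] a)"
    by (simp add: K.mpoly_eval_const)
  then show ?case by (rule exI)
next
  case (indexed_padd P Q)
  then obtain p q where
    "\<forall>x a. x 0 = h a \<longrightarrow> mpoly_eval K P x = h (poly p a)"
    "\<forall>x a. x 0 = h a \<longrightarrow> mpoly_eval K Q x = h (poly q a)" by blast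
  then have "\<forall>x a. x 0 = h a \<longrightarrow> mpoly_eval K (K.indexed_padd P Q) x = h (poly (p + q) a)"
    using K.mpoly_eval_padd[OF subset_refl indexed_padd.hyps] by (simp add: Pi_iff)
  then show ?case by (rule exI)
next
  case (indexed_pmult P i)
  then obtain p where p: "\<forall>x a. x 0 = h a \<longrightarrow> mpoly_eval K P x = h (poly p a)" by blast
  have "i = 0" using indexed_pmult.hyps by simp
  with p have "\<forall>x a. x 0 = h a \<longrightarrow>
      mpoly_eval K (K.indexed_pmult P i) x = h (poly (p * [:0, 1:]) a)"
    using K.mpoly_eval_pmult[OF subset_refl indexed_pmult.hyps] by (simp add: Pi_iff)
  then show ?case by (rule exI)
qed

text \<open>
  For weak polynomial completeness the coefficients may be forgotten: it suffices to
  consider polynomial functions in one variable on the field type.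
\<close>

lemma weakly_poly_completeI:
  assumes ext: "domain_extension K (h ` R) (h ` B)"
    and maps: "\<And>p. \<forall>a\<in>R. poly p a \<in> R \<Longrightarrow> \<forall>b\<in>B. poly p b \<in> B"
  shows "weakly_poly_complete K (h ` R) (h ` B)"
  unfolding weakly_poly_complete_def
proof
  fix F assume F: "F \<in> Int_ring K 1 (h ` R)"
  have sub: "subdomain (h ` R) K" "h ` R \<subseteq> h ` B"
    using ext by (simp_all add: domain_extension_def)
  have FR: "F \<in> K.indexed_pset {..<1} (quotient_field K (h ` R))"
    using F by (simp add: Int_ring_def Int_between_def)
  obtain p where p: "\<forall>x a. x 0 = h a \<longrightarrow> mpoly_eval K F x = h (poly p a)"
    using one_variable_poly_exists indexed_pset_mono[OF K.ring_axioms _ FR]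
      quotient_field_in_carrier[OF field_K sub(1)] by blast
  have "poly p a \<in> R" if "a \<in> R" for a
  proof -
    have "mpoly_eval K F (\<lambda>_. h a) \<in> h ` R"
      using F that by (simp add: Int_ring_def Int_between_def)
    with p show ?thesis by auto
  qed
  then have "poly p b \<in> B" if "b \<in> B" for b using maps that by blast
  then have "mpoly_eval K F x \<in> h ` B" if "x \<in> {..<1} \<rightarrow> h ` B" for x
    using p that by (fastforce simp: Pi_iff)
  moreover have "F \<in> K.indexed_pset {..<1} (quotient_field K (h ` B))"
    by (rule indexed_pset_mono[OF K.ring_axioms quotient_field_mono[OF sub(2)] FR])
  ultimately show "F \<in> Int_ring K 1 (h ` B)"
    by (simp add: Int_ring_def Int_between_def)
qed

text \<open>
  The product of \<open>G\<close> with \<open>X\<^sub>i\<^sup>2 + X\<^sub>i\<close>, the Artin--Schreier polynomial in characteristic 2.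
\<close>

definition times_artin_schreier :: "('v multiset \<Rightarrow> 'b) \<Rightarrow> 'v \<Rightarrow> 'v multiset \<Rightarrow> 'b" where
  "times_artin_schreier G i =
     K.indexed_padd (K.indexed_pmult (K.indexed_pmult G i) i) (K.indexed_pmult G i)"

lemma times_artin_schreier_in_indexed_pset:
  "G \<in> K.indexed_pset I S \<Longrightarrow> i \<in> I \<Longrightarrow> times_artin_schreier G i \<in> K.indexed_pset I S"
  unfolding times_artin_schreier_def by (intro K.indexed_pset.intros)

lemma mpoly_eval_times_artin_schreier:
  assumes "G \<in> K.indexed_pset I (carrier K)" "i \<in> I" "x \<in> I \<rightarrow> carrier K"
    and "mpoly_eval K G x = h g" "x i = h a"
  shows "mpoly_eval K (times_artin_schreier G i) x = h (g * (a ^ 2 + a))"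
proof -
  note G1 = K.indexed_pset.indexed_pmult[OF assms(1,2)]
  note G2 = K.indexed_pset.indexed_pmult[OF G1 assms(2)]
  show ?thesis
    unfolding times_artin_schreier_def
    by (simp add: K.mpoly_eval_padd[OF subset_refl G2 G1 assms(3)]
      K.mpoly_eval_pmult[OF subset_refl G1 assms(2,3)]
      K.mpoly_eval_pmult[OF subset_refl assms(1-3)] assms(4,5) algebra_simps power2_eq_square)
qed

text \<open>
  The witness is \<open>(X\<^sup>2 + X) / c\<close>.
\<close>

lemma not_poly_completeI:
  assumes "\<And>a. a \<in> R \<Longrightarrow> (a ^ 2 + a) / c \<in> B"
    and "1 \<in> B" "c \<in> B" "c \<noteq> 0"
    and "b \<in> B" "(b ^ 2 + b) / c \<notin> B"
  shows "\<not> poly_complete K (h ` R) (h ` B)"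
proof
  assume pc: "poly_complete K (h ` R) (h ` B)"
  let ?C = "K.indexed_const (h (1 / c)) :: nat multiset \<Rightarrow> 'b"
  define F where "F = times_artin_schreier ?C 0"
  have "?C \<in> K.indexed_pset {..<1} (quotient_field K (h ` B))"
    using assms by (intro K.indexed_pset.intros quotient_field_memI)
  then have F: "F \<in> K.indexed_pset {..<1} (quotient_field K (h ` B))"
    unfolding F_def by (rule times_artin_schreier_in_indexed_pset) simp
  have C: "?C \<in> K.indexed_pset {..<1} (carrier K)"
    by (intro K.indexed_pset.intros) simp
  have eval: "mpoly_eval K F x = h ((a ^ 2 + a) / c)" if "x 0 = h a" for x a
    unfolding F_def
    by (subst mpoly_eval_times_artin_schreier[OF C, where a = a and g = "1 / c"])
      (use that in \<open>simp_all add: K.mpoly_eval_const\<close>)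
  have "mpoly_eval K F x \<in> h ` B" if x: "x \<in> {..<1} \<rightarrow> h ` R" for x
  proof -
    obtain a where "a \<in> R" "x 0 = h a" using x by (auto simp: Pi_iff)
    with eval assms(1) show ?thesis by simp
  qed
  with F have "F \<in> Int_between K 1 (h ` R) (h ` B)" by (simp add: Int_between_def)
  then have "F \<in> Int_ring K 1 (h ` B)" using pc by (simp add: poly_complete_def)
  then have "mpoly_eval K F (\<lambda>_. h b) \<in> h ` B"
    using assms(5) by (simp add: Int_ring_def Int_between_def)
  with assms(6) show False by (auto simp: eval)
qed

text \<open>
  The witness is \<open>(X\<^sup>2 + X)(Y\<^sup>2 + Y) / c\<close>.
\<close>

lemma not_almost_poly_completeI:
  assumes ext: "domain_extension K (h ` R) (h ` B)"
    and "\<And>a b. a \<in> R \<Longrightarrow> b \<in> R \<Longrightarrow> (a ^ 2 + a) * (b ^ 2 + b) / c \<in> R"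
    and "1 \<in> R" "c \<in> R" "c \<noteq> 0"
    and "u \<in> B" "v \<in> B" "(u ^ 2 + u) * (v ^ 2 + v) / c \<notin> B"
  shows "\<not> almost_poly_complete K (h ` R) (h ` B)"
proof
  assume apc: "almost_poly_complete K (h ` R) (h ` B)"
  let ?C = "K.indexed_const (h (1 / c)) :: nat multiset \<Rightarrow> 'b"
  define F where "F = times_artin_schreier (times_artin_schreier ?C 0) 1"
  have "?C \<in> K.indexed_pset {..<2} (quotient_field K (h ` R))"
    using assms by (intro K.indexed_pset.intros quotient_field_memI)
  then have F: "F \<in> K.indexed_pset {..<2} (quotient_field K (h ` R))"
    unfolding F_def by (intro times_artin_schreier_in_indexed_pset) simp_all
  have C: "?C \<in> K.indexed_pset {..<2} (carrier K)"
    by (intro K.indexed_pset.intros) simp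
  then have G: "times_artin_schreier ?C 0 \<in> K.indexed_pset {..<2} (carrier K)"
    by (rule times_artin_schreier_in_indexed_pset) simp
  have eval: "mpoly_eval K F x = h ((a ^ 2 + a) * (b ^ 2 + b) / c)"
    if "x 0 = h a" "x 1 = h b" for x a b
  proof -
    have x: "x \<in> {..<2} \<rightarrow> carrier K" using that by (auto simp: less_2_cases_iff)
    have "mpoly_eval K ?C x = h (1 / c)" by (simp add: K.mpoly_eval_const)
    note mpoly_eval_times_artin_schreier[OF C _ x this that(1)]
    then have "mpoly_eval K (times_artin_schreier ?C 0) x = h (1 / c * (a ^ 2 + a))" by simp
    from mpoly_eval_times_artin_schreier[OF G _ x this that(2)] show ?thesis
      by (simp add: F_def)
  qed
  have "mpoly_eval K F x \<in> h ` R" if x: "x \<in> {..<2} \<rightarrow> h ` R" for x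
  proof -
    have "x 0 \<in> h ` R" "x 1 \<in> h ` R" using x by (auto simp: Pi_iff)
    then obtain a b where "a \<in> R" "b \<in> R" "x 0 = h a" "x 1 = h b" by blast
    with eval assms(2) show ?thesis by simp
  qed
  with F have "F \<in> Int_ring K 2 (h ` R)" by (simp add: Int_ring_def Int_between_def)
  then have "F \<in> Int_ring K 2 (h ` B)"
    using apc unfolding almost_poly_complete_def by (metis one_le_numeral subsetD)
  then have vals: "\<forall>x\<in>{..<2} \<rightarrow> h ` B. mpoly_eval K F x \<in> h ` B"
    by (simp add: Int_ring_def Int_between_def)
  define x where "x = (\<lambda>i::nat. if i = 0 then h u else h v)"
  have "x \<in> {..<2} \<rightarrow> h ` B" using assms(6,7) by (simp add: x_def Pi_iff)
  with vals have "mpoly_eval K F x \<in> h ` B" by blast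
  moreover have "mpoly_eval K F x = h ((u ^ 2 + u) * (v ^ 2 + v) / c)"
    by (rule eval) (simp_all add: x_def)
  ultimately show False using assms(8) by auto
qed

end

section \<open>The separating extensions\<close>

text \<open>
  The exponent 6 is the least one that leaves room for \<open>z\<^sup>5 = z\<^sup>2 z\<^sup>3\<close> to be missing from the module
  of \<open>power_closed_polys\<close> below, while every multiple of \<open>t\<close> belongs to it.
\<close>

abbreviation t_poly :: "'l::field poly" where "t_poly \<equiv> monom 1 6"

text \<open>
  This is the module \<open>V\<close> of the introduction, and \<open>power_closed_polys\<close> is \<open>M\<close>: each is given by the
  exponents that are missing.
\<close>

definition base_polys :: "'l::field poly set" where
  "base_polys = {v. \<forall>i\<in>{1, 2, 3, 5}. coeff v i = 0}"

definition power_closed_polys :: "'l::field poly set" where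
  "power_closed_polys = {m. \<forall>i\<in>{1, 5}. coeff m i = 0}"

lemma coeff_mult_upto_5:
  fixes p q :: "'l::field poly"
  shows "coeff (p * q) 1 = coeff p 0 * coeff q 1 + coeff p 1 * coeff q 0"
    and "coeff (p * q) 2 = coeff p 0 * coeff q 2 + coeff p 1 * coeff q 1 + coeff p 2 * coeff q 0"
    and "coeff (p * q) 3 = coeff p 0 * coeff q 3 + coeff p 1 * coeff q 2 + coeff p 2 * coeff q 1
           + coeff p 3 * coeff q 0"
    and "coeff (p * q) 5 = coeff p 0 * coeff q 5 + coeff p 1 * coeff q 4 + coeff p 2 * coeff q 3
           + coeff p 3 * coeff q 2 + coeff p 4 * coeff q 1 + coeff p 5 * coeff q 0"
  by (simp_all add: coeff_mult eval_nat_numeral)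

lemma base_mult_power_closed: "v \<in> base_polys \<Longrightarrow> m \<in> power_closed_polys \<Longrightarrow> v * m \<in> power_closed_polys"
  by (simp add: base_polys_def power_closed_polys_def coeff_mult_upto_5 del: One_nat_def)

lemma base_mult_base: "v \<in> base_polys \<Longrightarrow> w \<in> base_polys \<Longrightarrow> v * w \<in> base_polys"
  by (simp add: base_polys_def coeff_mult_upto_5 del: One_nat_def)

text \<open>
  In characteristic 2 the odd coefficients of a square vanish; the coefficient at \<open>z\<^sup>2\<close> is the square of
  that at \<open>z\<close>, which is zero by assumption.
\<close>

lemma square_power_closed_in_base:
  fixes m :: "'l::field poly"
  assumes "(2::'l) = 0" "m \<in> power_closed_polys"
  shows "m * m \<in> base_polys"
proof -
  have two: "x + x = 0" for x :: 'l using assms(1) by (metis mult_2 mult_zero_left)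
  show ?thesis
    using assms(2)
    by (simp add: base_polys_def power_closed_polys_def coeff_mult_upto_5 mult.commute two del: One_nat_def)
qed

text \<open>
  Since \<open>t\<close> times any polynomial is in both modules, \<open>F + tV\<close> and \<open>F + tM\<close> are rings, although \<open>M\<close>
  is not.
\<close>

lemma t_mult_in_base: "t_poly * p \<in> base_polys"
  by (simp add: base_polys_def coeff_monom_mult)

lemma base_subset_power_closed: "base_polys \<subseteq> power_closed_polys"
  by (auto simp: base_polys_def power_closed_polys_def)

definition base_ring :: "'l::field poly fract set" where
  "base_ring = two_cosets (to_fract t_poly) (to_fract ` base_polys)"

definition top_ring :: "'l::field poly fract set" where
  "top_ring = two_cosets (to_fract t_poly) (to_fract ` power_closed_polys)"

lemma two_eq_zero_fract_poly:
  assumes "(2::'l::field) = 0"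
  shows "(2 :: 'l poly fract) = 0"
proof -
  have "(1 + 1 :: 'l poly) = smult (1 + 1) 1" by (simp only: smult_add_left smult_1_left)
  then have "(1 + 1 :: 'l poly) = 0" using assms by (simp only: one_add_one smult_0_left)
  then have "to_fract (1 + 1 :: 'l poly) = 0" by (simp only: to_fract_0)
  moreover have "(2 :: 'l poly fract) = to_fract 1 + to_fract 1" by simp
  ultimately show ?thesis unfolding to_fract_add[symmetric] by (rule trans[rotated])
qed

lemma base_polys_add: "v \<in> base_polys \<Longrightarrow> w \<in> base_polys \<Longrightarrow> v + w \<in> base_polys"
  and base_polys_diff: "v \<in> base_polys \<Longrightarrow> w \<in> base_polys \<Longrightarrow> v - w \<in> base_polys"
  and power_closed_polys_add: "m \<in> power_closed_polys \<Longrightarrow> n \<in> power_closed_polys \<Longrightarrow> m + n \<in> power_closed_polys"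
  by (simp_all add: base_polys_def power_closed_polys_def)

lemma base_ring_subset_top_ring: "base_ring \<subseteq> top_ring"
  using base_subset_power_closed unfolding base_ring_def top_ring_def two_cosets_def by blast

lemma base_ring_closed:
  assumes "(2::'l::field) = 0"
  shows "1 \<in> (base_ring :: 'l poly fract set)"
    and "a \<in> base_ring \<Longrightarrow> - a \<in> (base_ring :: 'l poly fract set)"
    and "a \<in> base_ring \<Longrightarrow> b \<in> base_ring \<Longrightarrow> a + b \<in> (base_ring :: 'l poly fract set)"
    and "a \<in> base_ring \<Longrightarrow> b \<in> base_ring \<Longrightarrow> a * b \<in> (base_ring :: 'l poly fract set)"
proof -
  let ?V = "to_fract ` (base_polys :: 'l poly set)"
  have 0: "0 \<in> ?V" by (rule image_eqI[of _ _ 0]) (simp_all add: base_polys_def)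
  have add: "u + v \<in> ?V" if "u \<in> ?V" "v \<in> ?V" for u v
    using that by (auto simp flip: to_fract_add intro!: base_polys_add)
  have mult: "to_fract t_poly * (u * v) \<in> ?V" if "u \<in> ?V" "v \<in> ?V" for u v
    using that by (auto simp flip: to_fract_mult intro!: t_mult_in_base)
  note closed = two_cosets_closed[OF two_eq_zero_fract_poly[OF assms] 0 add mult]
  show "1 \<in> (base_ring :: 'l poly fract set)" unfolding base_ring_def by (rule closed)
  show "a \<in> base_ring \<Longrightarrow> - a \<in> (base_ring :: 'l poly fract set)" unfolding base_ring_def by (rule closed)
  show "a \<in> base_ring \<Longrightarrow> b \<in> base_ring \<Longrightarrow> a + b \<in> (base_ring :: 'l poly fract set)" unfolding base_ring_def by (rule closed)
  show "a \<in> base_ring \<Longrightarrow> b \<in> base_ring \<Longrightarrow> a * b \<in> (base_ring :: 'l poly fract set)" unfolding base_ring_def by (rule closed)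
qed

lemma top_ring_closed:
  assumes "(2::'l::field) = 0"
  shows "1 \<in> (top_ring :: 'l poly fract set)"
    and "a \<in> top_ring \<Longrightarrow> - a \<in> (top_ring :: 'l poly fract set)"
    and "a \<in> top_ring \<Longrightarrow> b \<in> top_ring \<Longrightarrow> a + b \<in> (top_ring :: 'l poly fract set)"
    and "a \<in> top_ring \<Longrightarrow> b \<in> top_ring \<Longrightarrow> a * b \<in> (top_ring :: 'l poly fract set)"
proof -
  let ?M = "to_fract ` (power_closed_polys :: 'l poly set)"
  have 0: "0 \<in> ?M" by (rule image_eqI[of _ _ 0]) (simp_all add: power_closed_polys_def)
  have add: "u + v \<in> ?M" if "u \<in> ?M" "v \<in> ?M" for u v
    using that by (auto simp flip: to_fract_add intro!: power_closed_polys_add)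
  have mult: "to_fract t_poly * (u * v) \<in> ?M" if "u \<in> ?M" "v \<in> ?M" for u v
    using that subsetD[OF base_subset_power_closed t_mult_in_base] by (auto simp flip: to_fract_mult intro!: imageI)
  note closed = two_cosets_closed[OF two_eq_zero_fract_poly[OF assms] 0 add mult]
  show "1 \<in> (top_ring :: 'l poly fract set)" unfolding top_ring_def by (rule closed)
  show "a \<in> top_ring \<Longrightarrow> - a \<in> (top_ring :: 'l poly fract set)" unfolding top_ring_def by (rule closed)
  show "a \<in> top_ring \<Longrightarrow> b \<in> top_ring \<Longrightarrow> a + b \<in> (top_ring :: 'l poly fract set)" unfolding top_ring_def by (rule closed)
  show "a \<in> top_ring \<Longrightarrow> b \<in> top_ring \<Longrightarrow> a * b \<in> (top_ring :: 'l poly fract set)" unfolding top_ring_def by (rule closed)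
qed

lemma poly_maps_top_ring:
  fixes p :: "'l::field poly fract poly"
  assumes "(2::'l) = 0" "infinite (UNIV :: 'l set)"
    and "\<forall>a\<in>base_ring. poly p a \<in> base_ring" "b \<in> top_ring"
  shows "poly p b \<in> top_ring"
proof -
  define L where "L = range (\<lambda>c::'l. to_fract [:c:])"
  let ?V = "to_fract ` (base_polys :: 'l poly set)" and ?M = "to_fract ` (power_closed_polys :: 'l poly set)"
  show ?thesis
    unfolding top_ring_def
  proof (rule maps_two_cosets[where L = L and V = ?V])
    show "infinite L"
      unfolding L_def using assms(2) by (subst finite_image_iff) (auto simp: inj_on_def)
    show "a - b \<in> L" if "a \<in> L" "b \<in> L" for a b
      using that by (auto simp: L_def simp flip: to_fract_diff)
    show "inverse a \<in> L" if a: "a \<in> L" for a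
    proof -
      obtain c where c: "a = to_fract [:c:]" using a by (auto simp: L_def)
      have "inverse a = to_fract [:inverse c:]"
      proof (cases "c = 0")
        case False
        then have "a * to_fract [:inverse c:] = 1"
          by (simp add: c flip: to_fract_mult one_pCons)
        then show ?thesis by (metis inverse_unique)
      qed (simp add: c)
      then show ?thesis by (auto simp: L_def)
    qed
    show "0 \<in> ?V" by (rule image_eqI[of _ _ 0]) (simp_all add: base_polys_def)
    show "u - v \<in> ?V" if "u \<in> ?V" "v \<in> ?V" for u v
      using that by (auto simp flip: to_fract_diff intro!: base_polys_diff)
    have LV: "[:c:] \<in> base_polys" for c :: 'l
      by (auto simp: base_polys_def coeff_pCons split: nat.split)
    then show "L \<subseteq> ?V" by (auto simp: L_def)
    show "a * u \<in> ?V" if "a \<in> L" "u \<in> ?V" for a u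
      using that LV by (auto simp: L_def simp del: mult_pCons_left simp flip: to_fract_mult intro!: imageI base_mult_base)
    show "0 \<in> ?M" by (rule image_eqI[of _ _ 0]) (simp_all add: power_closed_polys_def)
    show "1 \<in> ?M" by (rule image_eqI[of _ _ 1]) (simp_all add: power_closed_polys_def)
    show "u + v \<in> ?M" if "u \<in> ?M" "v \<in> ?M" for u v
      using that by (auto simp flip: to_fract_add intro!: power_closed_polys_add)
    show "v * m \<in> ?M" if "v \<in> ?V" "m \<in> ?M" for v m
      using that by (auto simp flip: to_fract_mult intro!: imageI base_mult_power_closed)
    show "m * m \<in> ?V" if "m \<in> ?M" for m
      using that by (auto simp flip: to_fract_mult intro!: imageI square_power_closed_in_base[OF assms(1)])
    show "poly p a \<in> two_cosets (to_fract t_poly) ?V" if "a \<in> two_cosets (to_fract t_poly) ?V" for a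
      using assms(3) that by (simp add: base_ring_def)
    show "b \<in> two_cosets (to_fract t_poly) ?M" using assms(4) by (simp add: top_ring_def)
  qed
qed

lemma artin_schreier_product_maps_base_ring:
  assumes "(2::'l::field) = 0" "a \<in> base_ring" "b \<in> (base_ring :: 'l poly fract set)"
  shows "(a ^ 2 + a) * (b ^ 2 + b) / to_fract t_poly \<in> base_ring"
proof -
  let ?t = "to_fract (t_poly :: 'l poly)"
  note two = two_eq_zero_fract_poly[OF assms(1)]
  obtain e v f w where ab: "a = e + ?t * to_fract v" "b = f + ?t * to_fract w"
    "e \<in> {0, 1}" "f \<in> {0, 1}" "v \<in> base_polys" "w \<in> base_polys"
    using assms(2,3) by (auto simp: base_ring_def two_cosets_def)
  define g where "g u = u + t_poly * (u * u)" for u :: "'l poly"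
  have g: "g v * g w \<in> base_polys"
    unfolding g_def using ab by (intro base_mult_base base_polys_add t_mult_in_base)
  have "a ^ 2 + a = ?t * to_fract (g v)" "b ^ 2 + b = ?t * to_fract (g w)"
    using square_add_self_two_cosets[OF two ab(1,3)] square_add_self_two_cosets[OF two ab(2,4)]
    by (simp_all add: g_def)
  moreover have "?t \<noteq> 0" by simp
  ultimately have "(a ^ 2 + a) * (b ^ 2 + b) / ?t = 0 + ?t * to_fract (g v * g w)"
    by (simp add: field_simps)
  also have "\<dots> \<in> base_ring"
    unfolding base_ring_def using g by (intro two_cosetsI imageI) simp
  finally show ?thesis .
qed

text \<open>
  The exponent 11 is a gap of the top ring: it would need \<open>z\<^sup>5\<close> in the module that is multiplied by
  \<open>t = z\<^sup>6\<close>.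
\<close>

lemma coeff_11_top_ring:
  assumes "to_fract f \<in> top_ring"
  shows "coeff f 11 = 0"
proof -
  obtain e m where e: "e \<in> {0, 1}" "m \<in> power_closed_polys" "to_fract f = e + to_fract t_poly * to_fract m"
    using assms by (auto simp: top_ring_def two_cosets_def)
  then obtain e' where "e' \<in> {0, 1}" "to_fract f = to_fract (e' + t_poly * m)"
    by (auto simp flip: to_fract_1 to_fract_mult to_fract_add) 
  then have "f = e' + t_poly * m" by (simp only: to_fract_eq_iff)
  with \<open>e' \<in> {0, 1}\<close> e(2) show ?thesis
    by (auto simp: power_closed_polys_def coeff_monom_mult)
qed

lemma top_ring_polynomial: "a \<in> top_ring \<Longrightarrow> \<exists>f. a = to_fract f"
  unfolding top_ring_def two_cosets_def
  by (auto simp flip: to_fract_1 to_fract_mult to_fract_add)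

text \<open>
  Here \<open>u = tz\<^sup>2\<close> and \<open>v = tz\<^sup>3\<close>, and the lowest term of \<open>(u\<^sup>2 + u)(v\<^sup>2 + v) / t\<close> is \<open>uv/t = z\<^sup>1\<^sup>1\<close>.
\<close>

lemma artin_schreier_product_not_in_top_ring:
  defines "u \<equiv> to_fract (monom 1 8 :: 'l::field poly)" and "v \<equiv> to_fract (monom 1 9 :: 'l poly)"
  shows "u \<in> top_ring" "v \<in> top_ring" "(u ^ 2 + u) * (v ^ 2 + v) / to_fract t_poly \<notin> top_ring"
proof -
  have "u = 0 + to_fract t_poly * to_fract (monom 1 2)" "v = 0 + to_fract t_poly * to_fract (monom 1 3)"
    by (simp_all add: u_def v_def mult_monom flip: to_fract_mult)
  then show "u \<in> top_ring" "v \<in> top_ring"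
    unfolding top_ring_def
    by (auto intro!: two_cosetsI simp only:) (auto simp: power_closed_polys_def coeff_monom)
  show "(u ^ 2 + u) * (v ^ 2 + v) / to_fract t_poly \<notin> top_ring"
  proof
    assume mem: "(u ^ 2 + u) * (v ^ 2 + v) / to_fract t_poly \<in> top_ring"
    then obtain f where f: "(u ^ 2 + u) * (v ^ 2 + v) / to_fract t_poly = to_fract f"
      using top_ring_polynomial by blast
    let ?P = "monom 1 34 + monom 1 25 + monom 1 26 + monom 1 17 :: 'l poly"
    have "(u ^ 2 + u) * (v ^ 2 + v) = to_fract ?P"
      by (simp add: u_def v_def power2_eq_square mult_monom algebra_simps flip: to_fract_mult to_fract_add)
    with f have "to_fract ?P = to_fract (t_poly * f)"
      by (simp add: field_simps)
    then have "?P = t_poly * f" by (simp only: to_fract_eq_iff)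
    then have "coeff ?P 17 = coeff (t_poly * f) 17" by simp
    then have "coeff f 11 = 1" by (simp add: coeff_monom_mult)
    moreover have "coeff f 11 = 0" using coeff_11_top_ring mem f by simp
    ultimately show False by simp
  qed
qed

text \<open>
  The value is \<open>1 + 1/t\<close>, which is not even a polynomial in \<open>z\<close>.
\<close>

lemma artin_schreier_quotient_not_in_top_ring:
  defines "t \<equiv> to_fract (t_poly :: 'l::field poly)"
  shows "(t ^ 2 + t) / t ^ 2 \<notin> top_ring"
proof
  assume "(t ^ 2 + t) / t ^ 2 \<in> top_ring"
  then obtain f where f: "(t ^ 2 + t) / t ^ 2 = to_fract f"
    using top_ring_polynomial by blast
  have "t \<noteq> 0" by (simp add: t_def)
  with f have "t ^ 2 + t = t ^ 2 * to_fract f" by (simp add: field_simps)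
  then have "to_fract (monom 1 12 + monom 1 6 :: 'l poly) = to_fract (monom 1 12 * f)"
    by (simp add: t_def power2_eq_square mult_monom flip: to_fract_mult to_fract_add)
  then have "monom 1 12 + monom 1 6 = monom 1 12 * f" by (simp only: to_fract_eq_iff)
  then have "coeff (monom 1 12 + monom 1 6) 6 = coeff (monom 1 12 * f) 6" by simp
  then show False by (simp add: coeff_monom_mult)
qed

lemma t_in_base_ring: "to_fract t_poly \<in> base_ring"
proof -
  have "to_fract t_poly = 0 + to_fract t_poly * to_fract (1 :: 'a poly)" by simp
  also have "\<dots> \<in> base_ring"
    unfolding base_ring_def by (intro two_cosetsI imageI) (simp_all add: base_polys_def)
  finally show ?thesis .
qed

lemma zero_one_subset_base_ring: "{0, 1} \<subseteq> (base_ring :: 'l::field poly fract set)"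
proof
  fix e :: "'l poly fract" assume e: "e \<in> {0, 1}"
  have "e = e + to_fract t_poly * to_fract 0" by simp
  also have "\<dots> \<in> base_ring"
    unfolding base_ring_def using e by (intro two_cosetsI imageI) (simp_all add: base_polys_def)
  finally show "e \<in> base_ring" .
qed

proposition weakly_not_almost_poly_complete_example:
  fixes h :: "'l::field poly fract \<Rightarrow> 'b"
  assumes two: "(2::'l) = 0" and inf: "infinite (UNIV :: 'l set)" and inj: "inj h"
  shows "\<exists>(K :: 'b ring) R B. domain_extension K R B \<and>
           weakly_poly_complete K R B \<and> \<not> almost_poly_complete K R B"
proof -
  interpret embedded_field h by unfold_locales (rule inj)
  have ext: "domain_extension K (h ` base_ring) (h ` top_ring)"
    unfolding domain_extension_def
    by (intro conjI field_K subdomain_image base_ring_closed[OF two] top_ring_closed[OF two] image_mono base_ring_subset_top_ring)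
  moreover have "weakly_poly_complete K (h ` base_ring) (h ` top_ring)"
    using poly_maps_top_ring[OF two inf] by (intro weakly_poly_completeI[OF ext]) blast
  moreover have "\<not> almost_poly_complete K (h ` base_ring) (h ` top_ring)"
    by (rule not_almost_poly_completeI[OF ext _ _ t_in_base_ring _ artin_schreier_product_not_in_top_ring])
      (use artin_schreier_product_maps_base_ring[OF two] base_ring_closed(1)[OF two] in auto)
  ultimately show ?thesis by blast
qed

proposition almost_not_poly_complete_example:
  fixes h :: "'l::field poly fract \<Rightarrow> 'b"
  assumes two: "(2::'l) = 0" and inj: "inj h"
  shows "\<exists>(K :: 'b ring) R B. domain_extension K R B \<and>
           almost_poly_complete K R B \<and> \<not> poly_complete K R B"
proof -
  interpret embedded_field h by unfold_locales (rule inj)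
  let ?F = "{0, 1} :: 'l poly fract set" and ?t = "to_fract (t_poly :: 'l poly)"
  note two' = two_eq_zero_fract_poly[OF two]
  have one: "1 + 1 = (0 :: 'l poly fract)" using two' by simp
  then have neg: "- 1 = (1 :: 'l poly fract)" by (metis add_eq_0_iff)
  have sub: "subdomain (h ` ?F) K"
    by (rule subdomain_image) (use one neg in auto)
  have ext: "domain_extension K (h ` ?F) (h ` top_ring)"
    unfolding domain_extension_def
    by (intro conjI field_K sub subdomain_image top_ring_closed[OF two] image_mono
      subset_trans[OF zero_one_subset_base_ring base_ring_subset_top_ring])
  moreover have "almost_poly_complete K (h ` ?F) (h ` top_ring)"
  proof (rule subfield_imp_almost_poly_complete[OF ext])
    have "quotient_field K (h ` ?F) \<subseteq> h ` ?F"
      unfolding quotient_field_def by (auto simp: m_inv_h)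
    with subset_quotient_field[OF field_K sub] show "quotient_field K (h ` ?F) = h ` ?F" by blast
  qed
  moreover have "\<not> poly_complete K (h ` ?F) (h ` top_ring)"
  proof (rule not_poly_completeI[where b = ?t and c = "?t ^ 2"])
    show t: "?t \<in> top_ring" using t_in_base_ring base_ring_subset_top_ring by blast
    show "?t ^ 2 \<in> top_ring" using top_ring_closed(4)[OF two t t] by (simp add: power2_eq_square)
    show "(a ^ 2 + a) / ?t ^ 2 \<in> top_ring" if "a \<in> ?F" for a
      using that two' zero_one_subset_base_ring base_ring_subset_top_ring by auto
  qed (use top_ring_closed(1)[OF two] artin_schreier_quotient_not_in_top_ring in auto)
  ultimately show ?thesis by blast
qed

lemma countable_UNIV_poly:
  assumes "countable (UNIV :: 'a::zero set)"
  shows "countable (UNIV :: 'a poly set)"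
proof (rule countable_image_inj_on)
  show "inj (coeffs :: 'a poly \<Rightarrow> 'a list)" by (simp add: inj_on_def coeffs_eq_iff)
  show "countable (range (coeffs :: 'a poly \<Rightarrow> 'a list))"
    using countable_lists[OF assms] by (auto intro: countable_subset)
qed

lemma countable_UNIV_fract:
  assumes "countable (UNIV :: 'a::idom set)"
  shows "countable (UNIV :: 'a fract set)"
proof -
  have "range (\<lambda>(a, b). Fract a b) = (UNIV :: 'a fract set)"
    by (auto simp: image_iff) (metis Fract_cases)
  moreover have "countable (UNIV :: ('a \<times> 'a) set)"
    using countable_SIGMA[OF assms, of "\<lambda>_. UNIV :: 'a set"] assms by simp
  ultimately show ?thesis by (metis countable_image)
qed

theorem corollary4p3:
  shows "(\<forall>(K :: 'a ring) R B. domain_extension K R B \<longrightarrow>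
            poly_complete K R B \<longrightarrow> almost_poly_complete K R B)
       \<and> (\<forall>(K :: 'a ring) R B. domain_extension K R B \<longrightarrow>
            almost_poly_complete K R B \<longrightarrow> weakly_poly_complete K R B)
       \<and> (\<exists>(K :: nat ring) R B. domain_extension K R B \<and>
            almost_poly_complete K R B \<and> \<not> poly_complete K R B)
       \<and> (\<exists>(K :: nat ring) R B. domain_extension K R B \<and>
            weakly_poly_complete K R B \<and> \<not> almost_poly_complete K R B)"
proof -
  have "finite (UNIV :: bit set)"
    by (rule finite_subset[of _ "{0, 1}"]) auto
  then have "countable (UNIV :: bit poly fract poly fract set)"
    by (intro countable_UNIV_fract countable_UNIV_poly countable_finite)
  then obtain h :: "bit poly fract poly fract \<Rightarrow> nat" where h: "inj h"
    by (auto simp: countable_def)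
  have two: "(2 :: bit poly fract) = 0"
    by (rule two_eq_zero_fract_poly) simp
  have "inj (\<lambda>n. to_fract (monom (1::bit) n))"
    by (rule injI) (simp add: monom_eq_iff')
  then have inf: "infinite (UNIV :: bit poly fract set)"
    by (meson finite_imageD finite_subset infinite_UNIV_nat subset_UNIV)
  show ?thesis
    using poly_complete_imp_almost_poly_complete almost_poly_complete_imp_weakly_poly_complete
      almost_not_poly_complete_example[OF two h] weakly_not_almost_poly_complete_example[OF two inf h]
    by blast
qed

end
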